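(* For every measurable $F:\Omega\to\mathbb R$, $$E\left[|D^+F|_{L^\infty(\sigma+\omega)}\right]=\int_{-\infty}^{+\infty}E\left[|D^+1_{\{F>t\}}|_{L^\infty(\sigma+\omega)}\right]dt,\qquad E\left[|D^-F|_{L^\infty(\sigma+\omega)}\right]=\int_{-\infty}^{+\infty}E\left[|D^-1_{\{F>t\}}|_{L^\infty(\sigma+\omega)}\right]dt,$$ and $$E\left[|D^+F|_{L^\infty(\sigma+\omega)}\right]+E\left[|D^-F|_{L^\infty(\sigma+\omega)}\right]=\int_{-\infty}^{\infty}E\left[|D1_{\{F>t\}}|_{L^\infty(\sigma+\omega)}\right]dt.$$
   Context: $X$ is a metric space with Borel $\sigma$-algebra $\mathcal B(X)$ and $\sigma$ is a finite diffuse (atomless) measure on $X$. $\Omega$ is the set of Radon measures $\omega=\sum_{i=1}^N\delta_{x_i}$ with pairwise distinct $x_i\in X$, $N\in\mathbb N\cup\{\infty\}$; $\omega$ is identified with the set $\{x_1,x_2,\dots\}$. $\mathcal F$ is the $\sigma$-algebra generated by the maps $\omega\mapsto\omega(B)$, $B\in\mathcal B(X)$, and $\pi$ is the Poisson measure on $(\Omega,\mathcal F)$ with intensity $\sigma$; $E$ is expectation under $\pi$. $D_xF(\omega)=(F(\omega)-F(\omega+\delta_x))1_{\{x\notin\omega\}}+(F(\omega)-F(\omega-\delta_x))1_{\{x\in\omega\}}$, $D_x^+F=\max(0,D_xF)$, $D_x^-F=-\min(0,D_xF)$. For each $\omega$, $|DF(\omega)|_{L^\infty(\sigma+\omega)}$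 is the essential supremum of $x\mapsto|D_xF(\omega)|$ with respect to the measure $\sigma+\omega$ on $X$, and similarly for $D^\pm F$. Both sides are allowed to be $+\infty$. *)

theory Defs
  imports "HOL-Probability.Probability"
begin

section \<open>Measures on a metric space\<close>

definition sum_measure :: "'a measure \<Rightarrow> 'a measure \<Rightarrow> 'a measure" where
  "sum_measure M N = measure_of (space M) (sets M) (\<lambda>A. emeasure M A + emeasure N A)"

definition radon_measure :: "'a::metric_space measure \<Rightarrow> bool" where
  "radon_measure M \<longleftrightarrow>
     sets M = sets borel \<and>
     (\<forall>x. \<exists>U. open U \<and> x \<in> U \<and> emeasure M U < \<infinity>) \<and>
     (\<forall>B \<in> sets borel. emeasure M B = (SUP K \<in> {K. compact K \<and> K \<subseteq> B}. emeasure M K))"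

definition diffuse_measure :: "'a::metric_space measure \<Rightarrow> bool" where
  "diffuse_measure M \<longleftrightarrow> sets M = sets borel \<and> (\<forall>x. emeasure M {x} = 0)"

section \<open>Configurations\<close>

text \<open>Configurations are kept as measures. The number \<open>N\<close> of points may be any finite number,
  including 0, or infinite; the Dirac measure at a point is \<^const>\<open>return\<close> \<^const>\<open>borel\<close>.\<close>

definition configurations :: "'a::metric_space measure set" where
  "configurations = {\<omega>. radon_measure \<omega> \<and>
     (\<exists>(N::enat) (x::nat \<Rightarrow> 'a). inj_on x {i. enat i < N} \<and>
        (\<forall>B \<in> sets borel.
           emeasure \<omega> B = (\<Sum>i. if enat i < N then emeasure (return borel (x i)) B else 0)))}"

definition configuration_space :: "'a::metric_space measure measure" where
  "configuration_space =
     (SUP B \<in> sets borel. vimage_algebra configurations (\<lambda>\<omega>. emeasure \<omega> B) borel)"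

text \<open>The set of points with which a configuration is identified.\<close>

definition points :: "'a::metric_space measure \<Rightarrow> 'a set" where
  "points \<omega> = {x. emeasure \<omega> {x} \<noteq> 0}"

text \<open>The Poisson probabilities are spelled out because \<^const>\<open>poisson_pmf\<close> is only specified for
  a strictly positive rate, whereas \<open>\<sigma> B = 0\<close> has to be allowed (there \<open>0 ^ 0 = 1\<close>).\<close>

definition poisson_measure :: "'a::metric_space measure \<Rightarrow> 'a measure measure \<Rightarrow> bool" where
  "poisson_measure \<sigma> \<pi> \<longleftrightarrow>
     prob_space \<pi> \<and> sets \<pi> = sets configuration_space \<and>
     (\<forall>B \<in> sets borel. \<forall>k::nat.
        measure \<pi> {\<omega> \<in> space \<pi>. emeasure \<omega> B = of_nat k}
          = measure \<sigma> B ^ k / fact k * exp (- measure \<sigma> B)) \<and>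
     (\<forall>(n::nat) (B::nat \<Rightarrow> 'a set).
        (\<forall>i<n. B i \<in> sets borel) \<and> disjoint_family_on B {..<n} \<longrightarrow>
        prob_space.indep_vars \<pi> (\<lambda>_. borel) (\<lambda>i \<omega>. emeasure \<omega> (B i)) {..<n})"

section \<open>The difference operator and its essential suprema\<close>

text \<open>Where an indicator vanishes, the other factor may evaluate \<open>F\<close> outside
  \<^const>\<open>configurations\<close>; as \<open>F\<close> is real-valued, the product is 0 all the same.\<close>

definition D :: "('a::metric_space measure \<Rightarrow> real) \<Rightarrow> 'a measure \<Rightarrow> 'a \<Rightarrow> real" where
  "D F \<omega> x =
     (F \<omega> - F (sum_measure \<omega> (return borel x))) * indicator {x. x \<notin> points \<omega>} x +
     (F \<omega> - F (diff_measure \<omega> (return borel x))) * indicator {x. x \<in> points \<omega>} x"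

definition D_plus :: "('a::metric_space measure \<Rightarrow> real) \<Rightarrow> 'a measure \<Rightarrow> 'a \<Rightarrow> real" where
  "D_plus F \<omega> x = max 0 (D F \<omega> x)"

definition D_minus :: "('a::metric_space measure \<Rightarrow> real) \<Rightarrow> 'a measure \<Rightarrow> 'a \<Rightarrow> real" where
  "D_minus F \<omega> x = - min 0 (D F \<omega> x)"

text \<open>The values lie in \<^typ>\<open>ennreal\<close>, so that infinite norms are allowed and the norm with respect
  to the null measure is 0.\<close>

definition Linfty_norm :: "'a measure \<Rightarrow> ('a \<Rightarrow> real) \<Rightarrow> ennreal" where
  "Linfty_norm M f = esssup M (\<lambda>x. ennreal \<bar>f x\<bar>)"

end

theory Submission
  imports Defs
begin

text \<open>
  For a fixed configuration \<open>\<omega>\<close>, write \<open>\<omega>\<^sup>x\<close> for \<open>\<omega>\<close> with the point \<open>x\<close> flipped (added or removed), so that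
  \<open>D\<^sub>x F \<omega> = F \<omega> - F \<omega>\<^sup>x\<close>. The norm of \<open>D\<^sup>+ 1\<^bsub>{F > t}\<^esub>\<close> is 1 if \<open>essinf\<^sub>x F \<omega>\<^sup>x \<le> t < F \<omega>\<close> and 0 otherwise,
  except possibly at the single level \<open>t = essinf\<^sub>x F \<omega>\<^sup>x\<close>; integrating in \<open>t\<close> gives the norm of \<open>D\<^sup>+ F\<close>.
  The case of \<open>D\<^sup>-\<close> is symmetric, and \<open>D\<^sup>+ 1\<^bsub>{F > t}\<^esub>\<close>, \<open>D\<^sup>- 1\<^bsub>{F > t}\<^esub>\<close> are never both nonzero at \<open>\<omega>\<close>.
  It remains to apply Tonelli's theorem, which requires joint measurability in \<open>(\<omega>, t)\<close>.
  Since \<open>X\<close> need not be separable, \<open>{(\<omega>, x). x \<in> \<omega>}\<close> need not be product measurable. However,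
  \<open>(\<omega>, x) \<mapsto> F (\<omega> + \<delta>\<^sub>x)\<close> on \<open>{x \<notin> \<omega>}\<close> and \<open>(\<omega>, x) \<mapsto> F (\<omega> - \<delta>\<^sub>x)\<close> on \<open>{x \<in> \<omega>}\<close> are restrictions of jointly
  measurable functions \<open>G\<close> and \<open>H\<close>, and these may replace \<open>F \<omega>\<^sup>x\<close> almost everywhere for \<open>\<sigma>\<close> and
  \<open>\<omega>\<close> respectively. As \<open>\<omega>\<close> is almost surely finite, both measures are finite kernels.
\<close>

section \<open>Extending measurable functions from an arbitrary subset\<close>

text \<open>As \<open>R\<close> is arbitrary, extension by 0 need not be measurable. Instead, a
  measurable set of the trace is \<open>R \<inter> B\<close> with \<open>B\<close> measurable in
  \<open>M\<close>, so its indicator extends to that of \<open>B\<close>; multiples, sums and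
  suprema of extensions then extend the corresponding functions.\<close>

lemma borel_measurable_ennreal_restrict_space_extend:
  fixes f :: "'b \<Rightarrow> ennreal"
  assumes "f \<in> borel_measurable (restrict_space M R)"
  shows "\<exists>g\<in>borel_measurable M. \<forall>x\<in>R \<inter> space M. g x = f x"
  using assms
proof (induction rule: borel_measurable_induct)
  case (cong f g)
  then show ?case by (auto simp: space_restrict_space)
next
  case (set A)
  then obtain B where "B \<in> sets M" "A = R \<inter> B"
    by (auto simp: sets_restrict_space)
  then show ?case
    by (intro bexI[of _ "indicator B"]) (auto simp: indicator_def)
next
  case (mult u c)
  from mult.IH obtain g where "g \<in> borel_measurable M" "\<forall>x\<in>R \<inter> space M. g x = u x" by blast
  then show ?case by (intro bexI[of _ "\<lambda>x. c * g x"]) auto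
next
  case (add u v)
  from add.IH obtain g h where "g \<in> borel_measurable M" "\<forall>x\<in>R \<inter> space M. g x = u x"
    "h \<in> borel_measurable M" "\<forall>x\<in>R \<inter> space M. h x = v x" by blast
  then show ?case by (intro bexI[of _ "\<lambda>x. h x + g x"]) auto
next
  case (seq U)
  from seq.IH obtain g where "\<And>i::nat. g i \<in> borel_measurable M"
    "\<And>i. \<forall>x\<in>R \<inter> space M. g i x = U i x" by metis
  then show ?case
    by (intro bexI[of _ "\<lambda>x. SUP i. g i x"]) (auto simp: image_comp)
qed

lemma borel_measurable_restrict_space_extend:
  fixes f :: "'b \<Rightarrow> real"
  assumes [measurable]: "f \<in> borel_measurable (restrict_space M R)"
  obtains g where "g \<in> borel_measurable M" "\<And>x. x \<in> R \<Longrightarrow> x \<in> space M \<Longrightarrow> g x = f x"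
proof -
  obtain g h where [measurable]: "g \<in> borel_measurable M" "h \<in> borel_measurable M"
    and eq: "\<forall>x\<in>R \<inter> space M. g x = ennreal (f x)" "\<forall>x\<in>R \<inter> space M. h x = ennreal (- f x)"
    using borel_measurable_ennreal_restrict_space_extend[of "\<lambda>x. ennreal (f x)" M R]
      borel_measurable_ennreal_restrict_space_extend[of "\<lambda>x. ennreal (- f x)" M R]
    by auto
  show thesis
  proof
    \<comment> \<open>\<open>ennreal\<close> truncates at 0, so \<open>g\<close> and
      \<open>h\<close> extend the positive and the negative part of \<open>f\<close>. Outside
      \<open>R\<close> they may be infinite, where \<open>enn2real\<close> gives 0.\<close>
    show "(\<lambda>x. enn2real (g x) - enn2real (h x)) \<in> borel_measurable M" by measurable
    show "enn2real (g x) - enn2real (h x) = f x" if "x \<in> R" "x \<in> space M" for x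
      using eq that by (cases "f x \<ge> 0") (auto simp: enn2real_ennreal ennreal_neg)
  qed
qed

section \<open>Finite kernels and sums of measures\<close>

text \<open>Induction over the Dynkin system generated by rectangles. On a rectangle the section has
  mass \<open>indicator a x * emeasure (k x) b\<close>; for complements, finiteness of
  \<open>k x\<close> allows subtraction; disjoint unions use countable additivity.\<close>

lemma measurable_emeasure_finite_kernel:
  assumes k: "\<And>x. x \<in> space M \<Longrightarrow> finite_measure (k x)" "\<And>x. x \<in> space M \<Longrightarrow> sets (k x) = sets N"
    and meas: "\<And>B. B \<in> sets N \<Longrightarrow> (\<lambda>x. emeasure (k x) B) \<in> borel_measurable M"
    and "Q \<in> sets (M \<Otimes>\<^sub>M N)"
  shows "(\<lambda>x. emeasure (k x) (Pair x -` Q)) \<in> borel_measurable M"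
    (is "?s Q \<in> _")
  using Int_stable_pair_measure_generator pair_measure_closed \<open>Q \<in> _\<close>
  unfolding sets_pair_measure
proof (induct rule: sigma_sets_induct_disjoint)
  case (basic A)
  then obtain a b where A: "A = a \<times> b" and [measurable]: "a \<in> sets M" "b \<in> sets N" by auto
  note meas[OF \<open>b \<in> sets N\<close>, measurable]
  have "?s A = (\<lambda>x. indicator a x * emeasure (k x) b)"
    by (auto simp: A indicator_def)
  also have "\<dots> \<in> borel_measurable M" by measurable
  finally show ?case .
next
  case (compl A)
  have eq: "?s (space M \<times> space N - A) x = emeasure (k x) (space N) - ?s A x" if "x \<in> space M" for x
  proof -
    interpret finite_measure "k x" using k that by auto
    have "Pair x -` A \<in> sets (k x)"
      using compl(1) k(2)[OF that] unfolding sets_pair_measure[symmetric] by (auto intro: sets_Pair1)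
    then have "emeasure (k x) (space (k x) - Pair x -` A) = emeasure (k x) (space (k x)) - ?s A x"
      by (intro emeasure_compl) auto
    moreover have "space (k x) = space N" using k(2)[OF that] by (rule sets_eq_imp_space_eq)
    moreover have "Pair x -` (space M \<times> space N - A) = space N - Pair x -` A" using that by auto
    ultimately show ?thesis by simp
  qed
  then show ?case
    using compl(2) meas[OF sets.top] by (subst measurable_cong[OF eq]) auto
next
  case (union F)
  have eq: "?s (\<Union>i. F i) x = (\<Sum>i. ?s (F i) x)" if "x \<in> space M" for x
  proof -
    have "range (\<lambda>i. Pair x -` F i) \<subseteq> sets (k x)"
      using union(2) k(2)[OF that] unfolding sets_pair_measure[symmetric]
      by (auto intro: sets_Pair1)
    then show ?thesis
      using union(1) by (simp add: suminf_emeasure disjoint_family_on_vimageI vimage_UN)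
  qed
  then show ?case
    using union(3) by (subst measurable_cong[OF eq]) auto
qed simp

lemma
  assumes "sets M = sets N"
  shows sets_sum_measure: "sets (sum_measure M N) = sets M"
    and space_sum_measure: "space (sum_measure M N) = space M"
    and emeasure_sum_measure: "A \<in> sets M \<Longrightarrow> emeasure (sum_measure M N) A = emeasure M A + emeasure N A"
proof -
  show "sets (sum_measure M N) = sets M" "space (sum_measure M N) = space M"
    by (auto simp: sum_measure_def)
  show "emeasure (sum_measure M N) A = emeasure M A + emeasure N A" if "A \<in> sets M"
    unfolding sum_measure_def
  proof (rule emeasure_measure_of_sigma[OF _ _ _ that])
    show "sigma_algebra (space M) (sets M)" ..
    show "positive (sets M) (\<lambda>A. emeasure M A + emeasure N A)" by (simp add: positive_def)
    show "countably_additive (sets M) (\<lambda>A. emeasure M A + emeasure N A)"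
      unfolding countably_additive_def using assms
      by (auto simp: suminf_add[symmetric] suminf_emeasure)
  qed
qed

lemma AE_sum_measure_iff:
  assumes "sets M = sets N"
  shows "(AE x in sum_measure M N. P x) \<longleftrightarrow> (AE x in M. P x) \<and> (AE x in N. P x)"
proof -
  have sp: "space N = space M" using assms by (rule sets_eq_imp_space_eq[symmetric])
  have null: "B \<in> null_sets (sum_measure M N) \<longleftrightarrow> B \<in> null_sets M \<and> B \<in> null_sets N" for B
    using assms emeasure_sum_measure[OF assms, of B] by (auto simp: null_sets_def sets_sum_measure)
  show ?thesis
  proof
    assume "AE x in sum_measure M N. P x"
    then obtain B where "{x \<in> space M. \<not> P x} \<subseteq> B" "B \<in> null_sets M" "B \<in> null_sets N"
      unfolding eventually_ae_filter space_sum_measure[OF assms] using null by blast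
    then show "(AE x in M. P x) \<and> (AE x in N. P x)"
      unfolding eventually_ae_filter sp by blast
  next
    assume "(AE x in M. P x) \<and> (AE x in N. P x)"
    then obtain B C where B: "{x \<in> space M. \<not> P x} \<subseteq> B" "B \<in> null_sets M"
      and C: "{x \<in> space M. \<not> P x} \<subseteq> C" "C \<in> null_sets N"
      unfolding eventually_ae_filter sp by blast
    \<comment> \<open>The two exceptional sets may differ, but their intersection still contains
      every point where \<open>P\<close> fails and is null for both measures.\<close>
    have "B \<inter> C \<in> null_sets M" "B \<inter> C \<in> null_sets N"
      using B C assms by (auto intro: null_set_Int1 null_set_Int2)
    then show "AE x in sum_measure M N. P x"
      unfolding eventually_ae_filter null using B C
      by (intro bexI[of _ "B \<inter> C"]) (auto simp: space_sum_measure[OF assms] null)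
  qed
qed

section \<open>Finite configurations, and adding or removing a point\<close>

text \<open>Finite mass leaves only finitely many atoms, and for a finite sum of Dirac measures the
  Radon property is automatic. This criterion makes it easy to verify that a modified configuration
  is again one; summing over a set \<open>P\<close> encodes that the points are distinct.\<close>

lemma finite_configuration_iff:
  fixes \<omega> :: "'a::metric_space measure"
  shows "\<omega> \<in> configurations \<and> emeasure \<omega> UNIV < \<infinity> \<longleftrightarrow>
    sets \<omega> = sets borel \<and> (\<exists>P. finite P \<and> (\<forall>B\<in>sets borel. emeasure \<omega> B = (\<Sum>p\<in>P. indicator B p)))"
    (is "?L \<longleftrightarrow> ?R")
proof
  assume L: ?L
  then obtain N :: enat and x :: "nat \<Rightarrow> 'a" where sets: "sets \<omega> = sets borel"
    and inj: "inj_on x {i. enat i < N}"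
    and em: "\<And>B. B \<in> sets borel \<Longrightarrow> emeasure \<omega> B = (\<Sum>i. if enat i < N then emeasure (return borel (x i)) B else 0)"
    unfolding configurations_def radon_measure_def by blast
  have "N \<noteq> \<infinity>"
  proof
    assume "N = \<infinity>"
    then have "emeasure \<omega> UNIV = (\<Sum>i::nat. 1)" using em[of UNIV] by (simp add: emeasure_return)
    also have "\<dots> = (\<integral>\<^sup>+ i. 1 \<partial>count_space (UNIV :: nat set))"
      by (rule nn_integral_count_space_nat[symmetric])
    also have "\<dots> = \<infinity>" by simp
    finally show False using L by simp
  qed
  then obtain n where N: "N = enat n" by auto
  have "emeasure \<omega> B = (\<Sum>p\<in>x ` {..<n}. indicator B p)" if "B \<in> sets borel" for B
  proof -
    have "emeasure \<omega> B = (\<Sum>i<n. indicator B (x i))"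
      unfolding em[OF that] N using that
      by (subst suminf_finite[of "{..<n}"]) (auto simp: emeasure_return)
    also have "\<dots> = (\<Sum>p\<in>x ` {..<n}. indicator B p)"
      using inj by (subst sum.reindex) (auto simp: N lessThan_def)
    finally show ?thesis .
  qed
  then show ?R using sets by blast
next
  assume ?R
  then obtain P where sets: "sets \<omega> = sets borel" and "finite P"
    and em: "\<And>B. B \<in> sets borel \<Longrightarrow> emeasure \<omega> B = (\<Sum>p\<in>P. indicator B p)" by blast
  have fin: "emeasure \<omega> UNIV < \<infinity>"
    using em[of UNIV] \<open>finite P\<close> by (simp add: less_top[symmetric] ennreal_of_nat_neq_top)
  have "emeasure \<omega> B = (SUP K\<in>{K. compact K \<and> K \<subseteq> B}. emeasure \<omega> K)" if B: "B \<in> sets borel" for B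
  proof (rule antisym)
    \<comment> \<open>\<open>P \<inter> B\<close> is finite, hence compact, and carries all the mass
      of \<open>B\<close>, so it attains the supremum in inner regularity.\<close>
    have c: "compact (P \<inter> B)" using \<open>finite P\<close> by (intro finite_imp_compact) auto
    then have "emeasure \<omega> B = emeasure \<omega> (P \<inter> B)"
      unfolding em[OF B] using em[of "P \<inter> B"] borel_compact[OF c]
      by (auto simp: indicator_def intro!: sum.cong)
    also have "\<dots> \<le> (SUP K\<in>{K. compact K \<and> K \<subseteq> B}. emeasure \<omega> K)"
      using c by (intro SUP_upper) auto
    finally show "emeasure \<omega> B \<le> (SUP K\<in>{K. compact K \<and> K \<subseteq> B}. emeasure \<omega> K)" .
    show "(SUP K\<in>{K. compact K \<and> K \<subseteq> B}. emeasure \<omega> K) \<le> emeasure \<omega> B"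
      using B sets by (intro SUP_least emeasure_mono) auto
  qed
  then have radon: "radon_measure \<omega>"
    unfolding radon_measure_def using sets fin by (auto intro!: exI[of _ UNIV])
  obtain x where x: "bij_betw x {..<card P} P"
    using \<open>finite P\<close> ex_bij_betw_nat_finite[of P] by (auto simp: atLeast0LessThan)
  have "emeasure \<omega> B = (\<Sum>i. if enat i < enat (card P) then emeasure (return borel (x i)) B else 0)"
    if B: "B \<in> sets borel" for B
  proof -
    have "emeasure \<omega> B = (\<Sum>i<card P. indicator B (x i))"
      unfolding em[OF B] using x by (simp add: sum.reindex_bij_betw)
    also have "\<dots> = (\<Sum>i. if enat i < enat (card P) then emeasure (return borel (x i)) B else 0)"
      using B by (subst suminf_finite[of "{..<card P}"]) (auto simp: emeasure_return)
    finally show ?thesis .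
  qed
  moreover have "inj_on x {i. enat i < enat (card P)}"
    using x by (simp add: bij_betw_def lessThan_def)
  ultimately show ?L
    unfolding configurations_def using radon fin by blast
qed

lemma points_finite_configuration:
  fixes \<omega> :: "'a::metric_space measure"
  assumes "\<omega> \<in> configurations" "emeasure \<omega> UNIV < \<infinity>"
  shows "finite (points \<omega>)"
    and "\<And>B. B \<in> sets borel \<Longrightarrow> emeasure \<omega> B = (\<Sum>p\<in>points \<omega>. indicator B p)"
proof -
  obtain P where P: "finite P" "\<And>B. B \<in> sets borel \<Longrightarrow> emeasure \<omega> B = (\<Sum>p\<in>P. indicator B p)"
    using finite_configuration_iff[of \<omega>] assms by blast
  have "points \<omega> = P" using P by (auto simp: points_def indicator_def)
  then show "finite (points \<omega>)"
    "\<And>B. B \<in> sets borel \<Longrightarrow> emeasure \<omega> B = (\<Sum>p\<in>points \<omega>. indicator B p)"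
    using P by auto
qed

lemma sets_configuration: "\<omega> \<in> configurations \<Longrightarrow> sets \<omega> = sets borel"
  by (simp add: configurations_def radon_measure_def)

text \<open>Because \<open>x\<close> is new, the enlarged measure is the sum over the set
  \<open>insert x (points \<omega>)\<close>; adding an existing point would create an atom of mass
  2.\<close>

lemma add_point_configuration:
  fixes \<omega> :: "'a::metric_space measure"
  assumes \<omega>: "\<omega> \<in> configurations" "emeasure \<omega> UNIV < \<infinity>" and x: "x \<notin> points \<omega>"
  shows "sum_measure \<omega> (return borel x) \<in> configurations"
    and "B \<in> sets borel \<Longrightarrow> emeasure (sum_measure \<omega> (return borel x)) B = emeasure \<omega> B + indicator B x"
proof -
  have s: "sets \<omega> = sets (return borel x)" using \<omega> by (simp add: sets_configuration)
  show em: "emeasure (sum_measure \<omega> (return borel x)) B = emeasure \<omega> B + indicator B x"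
    if "B \<in> sets borel" for B
    using that s by (simp add: emeasure_sum_measure emeasure_return)
  have "sets (sum_measure \<omega> (return borel x)) = sets borel"
    using sets_sum_measure[OF s] s by simp
  moreover have "\<forall>B\<in>sets borel. emeasure (sum_measure \<omega> (return borel x)) B
      = (\<Sum>p\<in>insert x (points \<omega>). indicator B p)"
    using x points_finite_configuration[OF \<omega>] by (simp add: em add.commute)
  ultimately show "sum_measure \<omega> (return borel x) \<in> configurations"
    using finite_configuration_iff[of "sum_measure \<omega> (return borel x)"]
      points_finite_configuration(1)[OF \<omega>] by (meson finite.insertI)
qed

lemma remove_point_configuration:
  fixes \<omega> :: "'a::metric_space measure"
  assumes \<omega>: "\<omega> \<in> configurations" "emeasure \<omega> UNIV < \<infinity>" and x: "x \<in> points \<omega>"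
  shows "diff_measure \<omega> (return borel x) \<in> configurations"
    and "B \<in> sets borel \<Longrightarrow> emeasure (diff_measure \<omega> (return borel x)) B = emeasure \<omega> B - indicator B x"
proof -
  note P = points_finite_configuration[OF \<omega>]
  have s: "sets \<omega> = sets (return borel x)" and s': "sets \<omega> = sets borel"
    using \<omega> by (simp_all add: sets_configuration)
  \<comment> \<open>Splitting off the summand of \<open>x\<close> shows that \<omega> dominates the
    Dirac measure at \<open>x\<close>, as the formula for the mass under \<open>diff_measure\<close>
    requires.\<close>
  have sum: "emeasure \<omega> B = indicator B x + (\<Sum>p\<in>points \<omega> - {x}. indicator B p)" if "B \<in> sets borel" for B
    unfolding P(2)[OF that] using P(1) x by (simp add: sum.remove)
  have "finite_measure \<omega>"
    using \<omega> sets_eq_imp_space_eq[OF s'] by (intro finite_measureI) auto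
  moreover have "finite_measure (return borel x)"
    by (intro prob_space.finite_measure prob_space_return) simp
  ultimately show em: "emeasure (diff_measure \<omega> (return borel x)) B = emeasure \<omega> B - indicator B x"
    if "B \<in> sets borel" for B
    using that s sum by (subst emeasure_diff_measure) (auto simp: emeasure_return)
  have "sets (diff_measure \<omega> (return borel x)) = sets borel" using s by simp
  moreover have "\<forall>B\<in>sets borel. emeasure (diff_measure \<omega> (return borel x)) B
      = (\<Sum>p\<in>points \<omega> - {x}. indicator B p)"
  proof
    fix B :: "'a set" assume B: "B \<in> sets borel"
    \<comment> \<open>In \<open>ennreal\<close>, subtraction cancels a summand only if it is
      finite.\<close>
    have "indicator B x \<noteq> (\<top>::ennreal)" by (auto simp: indicator_def)
    then show "emeasure (diff_measure \<omega> (return borel x)) B = (\<Sum>p\<in>points \<omega> - {x}. indicator B p)"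
      using B by (simp add: em sum[OF B])
  qed
  ultimately show "diff_measure \<omega> (return borel x) \<in> configurations"
    using finite_configuration_iff[of "diff_measure \<omega> (return borel x)"] P(1)
    by (meson finite_Diff)
qed

section \<open>The sigma-algebra on configurations, and almost-everywhere statements under
  kernels\<close>

lemma space_configuration_space: "space configuration_space = configurations"
  unfolding configuration_space_def space_Sup_eq_UN by auto

lemma measurable_emeasure_configuration_space:
  "B \<in> sets borel \<Longrightarrow> (\<lambda>\<omega>. emeasure \<omega> B) \<in> borel_measurable configuration_space"
  unfolding configuration_space_def
  by (rule measurable_SUP1[where i=B]) (auto intro: measurable_vimage_algebra1)

lemma measurable_configuration_spaceI:
  assumes "\<And>x. x \<in> space N \<Longrightarrow> f x \<in> configurations"
    and "\<And>B. B \<in> sets borel \<Longrightarrow> (\<lambda>x. emeasure (f x) B) \<in> borel_measurable N"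
  shows "f \<in> N \<rightarrow>\<^sub>M configuration_space"
  unfolding configuration_space_def
  using assms by (intro measurable_SUP2 measurable_vimage_algebra2) auto

text \<open>The condition says that the section of the exceptional set has \<open>k x\<close>-mass
  0, and this mass is measurable in \<open>x\<close>.\<close>

lemma sets_AE_finite_kernel:
  assumes k: "\<And>x. x \<in> space M \<Longrightarrow> finite_measure (k x)" "\<And>x. x \<in> space M \<Longrightarrow> sets (k x) = sets N"
    and meas: "\<And>B. B \<in> sets N \<Longrightarrow> (\<lambda>x. emeasure (k x) B) \<in> borel_measurable M"
    and Q[measurable]: "Measurable.pred (M \<Otimes>\<^sub>M N) (\<lambda>(x, y). Q x y)"
  shows "{x \<in> space M. AE y in k x. Q x y} \<in> sets M"
proof -
  let ?S = "{z \<in> space (M \<Otimes>\<^sub>M N). \<not> (case z of (x, y) \<Rightarrow> Q x y)}"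
  have S: "?S \<in> sets (M \<Otimes>\<^sub>M N)" by measurable
  have "(AE y in k x. Q x y) \<longleftrightarrow> emeasure (k x) (Pair x -` ?S) = 0" if x: "x \<in> space M" for x
  proof (rule AE_iff_measurable)
    have "Pair x -` ?S \<in> sets N" using S by (rule sets_Pair1)
    then show "Pair x -` ?S \<in> sets (k x)" using k(2)[OF x] by simp
    show "{y \<in> space (k x). \<not> Q x y} = Pair x -` ?S"
      using x sets_eq_imp_space_eq[OF k(2)[OF x]] by (auto simp: space_pair_measure)
  qed
  then have "{x \<in> space M. AE y in k x. Q x y} = {x \<in> space M. emeasure (k x) (Pair x -` ?S) = 0}"
    by auto
  also have "\<dots> \<in> sets M"
    using measurable_emeasure_finite_kernel[OF k meas S] by measurable
  finally show ?thesis .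
qed

section \<open>Joint measurability of flipping a point\<close>

text \<open>This is \<open>\<omega>\<^sup>x\<close>; merging the two cases turns \<open>D\<close>
  into a single difference.\<close>

definition flip_point :: "'a::metric_space measure \<Rightarrow> 'a \<Rightarrow> 'a measure" where
  "flip_point \<omega> x = (if x \<in> points \<omega> then diff_measure \<omega> (return borel x) else sum_measure \<omega> (return borel x))"

lemma D_eq_flip_point: "D F \<omega> x = F \<omega> - F (flip_point \<omega> x)"
  by (auto simp: D_def flip_point_def)

text \<open>The set of pairs with \<open>x \<in> points \<omega>\<close> is only used as the carrier
  of a trace. On it and on its complement, the flip is measurable into
  \<open>configuration_space\<close>; composing with \<open>F\<close> and extending from the traces
  gives \<open>H\<close> and \<open>G\<close>.\<close>

lemma flip_point_measurable_extension:
  fixes F :: "'a::metric_space measure \<Rightarrow> real"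
  assumes F: "F \<in> borel_measurable configuration_space"
  obtains G H where "G \<in> borel_measurable (configuration_space \<Otimes>\<^sub>M borel)"
    "H \<in> borel_measurable (configuration_space \<Otimes>\<^sub>M borel)"
    "\<And>\<omega> x. \<omega> \<in> configurations \<Longrightarrow> emeasure \<omega> UNIV < \<infinity> \<Longrightarrow> x \<notin> points \<omega> \<Longrightarrow> G (\<omega>, x) = F (flip_point \<omega> x)"
    "\<And>\<omega> x. \<omega> \<in> configurations \<Longrightarrow> emeasure \<omega> UNIV < \<infinity> \<Longrightarrow> x \<in> points \<omega> \<Longrightarrow> H (\<omega>, x) = F (flip_point \<omega> x)"
proof -
  let ?M = "configuration_space \<Otimes>\<^sub>M (borel :: 'a measure)"
  let ?flip = "\<lambda>(\<omega>::'a measure, x). flip_point \<omega> x"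
  let ?out = "{(\<omega>::'a measure, x). emeasure \<omega> UNIV < \<infinity> \<and> x \<notin> points \<omega>}"
  let ?in = "{(\<omega>::'a measure, x). emeasure \<omega> UNIV < \<infinity> \<and> x \<in> points \<omega>}"
  have em: "(\<lambda>z. emeasure (fst z) B) \<in> borel_measurable ?M" if "B \<in> sets borel" for B :: "'a set"
    using measurable_emeasure_configuration_space[OF that] by measurable
  have ind: "(\<lambda>z. indicator B (snd z) :: ennreal) \<in> borel_measurable ?M" if "B \<in> sets borel" for B
    using that by measurable
  have "?flip \<in> restrict_space ?M ?out \<rightarrow>\<^sub>M configuration_space"
  proof (rule measurable_configuration_spaceI)
    fix B :: "'a set" assume B: "B \<in> sets borel"
    \<comment> \<open>On \<open>?out\<close> the mass of the flipped configuration coincides with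
      this function, which is measurable on the whole product; on \<open>?in\<close> below, the
      indicator is subtracted instead.\<close>
    have "(\<lambda>z. emeasure (fst z) B + indicator B (snd z)) \<in> borel_measurable (restrict_space ?M ?out)"
      by (intro measurable_restrict_space1 borel_measurable_add em[OF B] ind[OF B])
    then show "(\<lambda>z. emeasure (?flip z) B) \<in> borel_measurable (restrict_space ?M ?out)"
      by (rule measurable_cong[THEN iffD1, rotated])
        (auto simp: space_restrict_space space_pair_measure space_configuration_space flip_point_def
          add_point_configuration(2)[OF _ _ _ B])
  qed (auto simp: space_restrict_space space_pair_measure space_configuration_space flip_point_def
         add_point_configuration(1))
  from measurable_compose[OF this F] obtain G where G: "G \<in> borel_measurable ?M"
    and G': "\<And>z. z \<in> ?out \<Longrightarrow> z \<in> space ?M \<Longrightarrow> G z = F (?flip z)"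
    by (rule borel_measurable_restrict_space_extend) blast
  have "?flip \<in> restrict_space ?M ?in \<rightarrow>\<^sub>M configuration_space"
  proof (rule measurable_configuration_spaceI)
    fix B :: "'a set" assume B: "B \<in> sets borel"
    have "(\<lambda>z. emeasure (fst z) B - indicator B (snd z)) \<in> borel_measurable (restrict_space ?M ?in)"
      by (intro measurable_restrict_space1 borel_measurable_minus_ennreal em[OF B] ind[OF B])
    then show "(\<lambda>z. emeasure (?flip z) B) \<in> borel_measurable (restrict_space ?M ?in)"
      by (rule measurable_cong[THEN iffD1, rotated])
        (auto simp: space_restrict_space space_pair_measure space_configuration_space flip_point_def
          remove_point_configuration(2)[OF _ _ _ B])
  qed (auto simp: space_restrict_space space_pair_measure space_configuration_space flip_point_def
         remove_point_configuration(1))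
  from measurable_compose[OF this F] obtain H where H: "H \<in> borel_measurable ?M"
    and H': "\<And>z. z \<in> ?in \<Longrightarrow> z \<in> space ?M \<Longrightarrow> H z = F (?flip z)"
    by (rule borel_measurable_restrict_space_extend) blast
  show thesis
  proof (rule that[OF G H])
    show "G (\<omega>, x) = F (flip_point \<omega> x)"
      if "\<omega> \<in> configurations" "emeasure \<omega> UNIV < \<infinity>" "x \<notin> points \<omega>" for \<omega> x
      using that G'[of "(\<omega>, x)"] by (simp add: space_pair_measure space_configuration_space)
    show "H (\<omega>, x) = F (flip_point \<omega> x)"
      if "\<omega> \<in> configurations" "emeasure \<omega> UNIV < \<infinity>" "x \<in> points \<omega>" for \<omega> x
      using that H'[of "(\<omega>, x)"] by (simp add: space_pair_measure space_configuration_space)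
  qed
qed

text \<open>The section of \<open>G\<close> at \<omega> can differ from this function only on the
  finite set \<open>points \<omega>\<close>, and altering a Borel function at countably many points
  keeps it Borel.\<close>

lemma borel_measurable_flip_point:
  fixes F :: "'a::metric_space measure \<Rightarrow> real"
  assumes F: "F \<in> borel_measurable configuration_space"
    and \<omega>: "\<omega> \<in> configurations" "emeasure \<omega> UNIV < \<infinity>"
  shows "(\<lambda>x. F (flip_point \<omega> x)) \<in> borel_measurable borel"
proof -
  obtain G H where "G \<in> borel_measurable (configuration_space \<Otimes>\<^sub>M borel)"
    and eq: "\<And>x. x \<notin> points \<omega> \<Longrightarrow> G (\<omega>, x) = F (flip_point \<omega> x)"
    using \<omega> by (auto intro: flip_point_measurable_extension[OF F])
  then have "(\<lambda>x. G (\<omega>, x)) \<in> borel_measurable borel"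
    using \<omega> by (simp add: space_configuration_space)
  then show ?thesis
    by (rule measurable_discrete_difference[of _ _ _ "points \<omega>"])
      (use points_finite_configuration(1)[OF \<omega>] eq in \<open>auto intro: countable_finite\<close>)
qed

text \<open>Every point of \<omega> has positive mass, so a null set contains none of them;
  conversely the complement of the points is itself a null set.\<close>

lemma AE_finite_configuration_iff:
  assumes "\<omega> \<in> configurations" "emeasure \<omega> UNIV < \<infinity>"
  shows "(AE x in \<omega>. P x) \<longleftrightarrow> (\<forall>x\<in>points \<omega>. P x)"
proof
  have sp: "space \<omega> = UNIV" using sets_eq_imp_space_eq[OF sets_configuration[OF assms(1)]] by simp
  note P = points_finite_configuration[OF assms]
  {
    assume "AE x in \<omega>. P x"
    then obtain B where B: "{x. \<not> P x} \<subseteq> B" "B \<in> null_sets \<omega>"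
      unfolding eventually_ae_filter sp by auto
    then have "(\<Sum>p\<in>points \<omega>. indicator B p) = (0::ennreal)"
      using P(2)[of B] sets_configuration[OF assms(1)] by (auto simp: null_sets_def)
    then show "\<forall>x\<in>points \<omega>. P x" using P(1) B by (auto simp: indicator_def)
  next
    assume *: "\<forall>x\<in>points \<omega>. P x"
    have "- points \<omega> \<in> sets borel"
      using P(1) by (intro borel_open open_Compl finite_imp_closed)
    then have "- points \<omega> \<in> null_sets \<omega>"
      using P(2)[of "- points \<omega>"] sets_configuration[OF assms(1)] by (auto simp: null_sets_def)
    then show "AE x in \<omega>. P x"
      by (rule AE_I') (use * in auto)
  }
qed

lemma AE_notin_points:
  assumes "diffuse_measure \<sigma>" "\<omega> \<in> configurations" "emeasure \<omega> UNIV < \<infinity>"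
  shows "AE x in \<sigma>. x \<notin> points \<omega>"
proof (rule AE_discrete_difference)
  show "countable (points \<omega>)"
    using points_finite_configuration(1)[OF assms(2,3)] by (rule countable_finite)
qed (use assms(1) in \<open>auto simp: diffuse_measure_def\<close>)

text \<open>The statement under the sum splits into one for \<sigma> and one for \<omega>. In the
  first, \<open>G\<close> may replace the flip since the diffuse \<sigma> does not charge the
  finitely many points; in the second, \<open>H\<close> may, since \<omega> lives on its points. A
  general \<open>Q\<close> serves both the strict and the non-strict comparison with
  \<open>t\<close>.\<close>

lemma sets_AE_flip_point:
  fixes F :: "'a::metric_space measure \<Rightarrow> real"
  assumes \<sigma>: "finite_measure \<sigma>" "diffuse_measure \<sigma>"
    and F: "F \<in> borel_measurable configuration_space"
    and Q[measurable]: "Measurable.pred (borel \<Otimes>\<^sub>M borel) (\<lambda>(s, t). Q s t)"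
  obtains A where "A \<in> sets (configuration_space \<Otimes>\<^sub>M (borel :: real measure))"
    "\<And>\<omega> t. \<omega> \<in> configurations \<Longrightarrow> emeasure \<omega> UNIV < \<infinity> \<Longrightarrow>
      (\<omega>, t) \<in> A \<longleftrightarrow> (AE x in sum_measure \<sigma> \<omega>. Q (F (flip_point \<omega> x)) t)"
proof -
  obtain G H where [measurable]: "G \<in> borel_measurable (configuration_space \<Otimes>\<^sub>M borel)"
      "H \<in> borel_measurable (configuration_space \<Otimes>\<^sub>M borel)"
    and G: "\<And>\<omega> x. \<omega> \<in> configurations \<Longrightarrow> emeasure \<omega> UNIV < \<infinity> \<Longrightarrow> x \<notin> points \<omega> \<Longrightarrow> G (\<omega>, x) = F (flip_point \<omega> x)"
    and H: "\<And>\<omega> x. \<omega> \<in> configurations \<Longrightarrow> emeasure \<omega> UNIV < \<infinity> \<Longrightarrow> x \<in> points \<omega> \<Longrightarrow> H (\<omega>, x) = F (flip_point \<omega> x)"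
    using flip_point_measurable_extension[OF F] by blast
  let ?M = "(configuration_space :: 'a measure measure) \<Otimes>\<^sub>M (borel :: real measure)"
  \<comment> \<open>Configurations of infinite mass are sent to the null measure, so that
    \<open>k\<close> is a finite kernel on the whole space; on those of finite mass it is \<omega>
    itself.\<close>
  define k :: "'a measure \<times> real \<Rightarrow> 'a measure" where
    "k = (\<lambda>(\<omega>, t). if emeasure \<omega> UNIV < \<infinity> then \<omega> else null_measure borel)"
  have pred: "Measurable.pred (?M \<Otimes>\<^sub>M borel) (\<lambda>((\<omega>, t), x). Q (L (\<omega>, x)) t)"
    if [measurable]: "L \<in> borel_measurable (configuration_space \<Otimes>\<^sub>M borel)" for L :: "'a measure \<times> 'a \<Rightarrow> real"
  proof -
    have "(\<lambda>z. (L (fst (fst z), snd z), snd (fst z))) \<in> ?M \<Otimes>\<^sub>M borel \<rightarrow>\<^sub>M borel \<Otimes>\<^sub>M borel"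
      by measurable
    from measurable_compose[OF this Q] show ?thesis by (simp add: case_prod_unfold)
  qed
  define A1 where "A1 = {z \<in> space ?M. AE x in \<sigma>. case z of (\<omega>, t) \<Rightarrow> Q (G (\<omega>, x)) t}"
  define A2 where "A2 = {z \<in> space ?M. AE x in k z. case z of (\<omega>, t) \<Rightarrow> Q (H (\<omega>, x)) t}"
  have [measurable]: "A1 \<in> sets ?M"
    unfolding A1_def
  proof (rule sets_AE_finite_kernel[where N=borel])
    show "sets \<sigma> = sets borel" using \<sigma> by (simp add: diffuse_measure_def)
    show "Measurable.pred (?M \<Otimes>\<^sub>M borel) (\<lambda>(z, x). case z of (\<omega>, t) \<Rightarrow> Q (G (\<omega>, x)) t)"
      using pred[of G] by (simp add: case_prod_unfold)
  qed (use \<sigma> in auto)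
  have [measurable]: "A2 \<in> sets ?M"
    unfolding A2_def
  proof (rule sets_AE_finite_kernel[where N=borel])
    fix z assume z: "z \<in> space ?M"
    then show s: "sets (k z) = sets borel"
      by (auto simp: k_def space_pair_measure space_configuration_space sets_configuration split: prod.split)
    have "space (k z) = UNIV" using sets_eq_imp_space_eq[OF s] by simp
    then show "finite_measure (k z)"
      by (intro finite_measureI) (auto simp: k_def split: prod.split)
  next
    fix B :: "'a set" assume B: "B \<in> sets borel"
    note measurable_emeasure_configuration_space[OF B, measurable]
    have [measurable]: "(\<lambda>\<omega>. emeasure \<omega> UNIV) \<in> borel_measurable (configuration_space :: 'a measure measure)"
      by (rule measurable_emeasure_configuration_space) simp
    have "(\<lambda>z. emeasure (k z) B) = (\<lambda>z. if emeasure (fst z) UNIV < \<infinity> then emeasure (fst z) B else 0)"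
      by (auto simp: k_def fun_eq_iff)
    also have "\<dots> \<in> borel_measurable ?M" by measurable
    finally show "(\<lambda>z. emeasure (k z) B) \<in> borel_measurable ?M" .
  next
    show "Measurable.pred (?M \<Otimes>\<^sub>M borel) (\<lambda>(z, x). case z of (\<omega>, t) \<Rightarrow> Q (H (\<omega>, x)) t)"
      using pred[of H] by (simp add: case_prod_unfold)
  qed
  show thesis
  proof
    show "A1 \<inter> A2 \<in> sets ?M" by measurable
    fix \<omega> :: "'a measure" and t :: real
    assume \<omega>: "\<omega> \<in> configurations" "emeasure \<omega> UNIV < \<infinity>"
    have "sets \<sigma> = sets \<omega>" using \<sigma> sets_configuration[OF \<omega>(1)] by (simp add: diffuse_measure_def)
    then have "(AE x in sum_measure \<sigma> \<omega>. Q (F (flip_point \<omega> x)) t) \<longleftrightarrow>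
        (AE x in \<sigma>. Q (F (flip_point \<omega> x)) t) \<and> (AE x in \<omega>. Q (F (flip_point \<omega> x)) t)"
      by (rule AE_sum_measure_iff)
    moreover have "(AE x in \<sigma>. Q (F (flip_point \<omega> x)) t) \<longleftrightarrow> (AE x in \<sigma>. Q (G (\<omega>, x)) t)"
      using AE_notin_points[OF \<sigma>(2) \<omega>] by (intro eventually_subst) (auto simp: G[OF \<omega>])
    moreover have "(AE x in \<omega>. Q (F (flip_point \<omega> x)) t) \<longleftrightarrow> (AE x in \<omega>. Q (H (\<omega>, x)) t)"
      unfolding AE_finite_configuration_iff[OF \<omega>] by (simp add: H[OF \<omega>])
    moreover have "k (\<omega>, t) = \<omega>" using \<omega> by (simp add: k_def)
    moreover have "(\<omega>, t) \<in> A1 \<inter> A2 \<longleftrightarrow>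
        (AE x in \<sigma>. Q (G (\<omega>, x)) t) \<and> (AE x in k (\<omega>, t). Q (H (\<omega>, x)) t)"
      using \<omega>(1) by (simp add: A1_def A2_def space_pair_measure space_configuration_space)
    ultimately show "(\<omega>, t) \<in> A1 \<inter> A2 \<longleftrightarrow> (AE x in sum_measure \<sigma> \<omega>. Q (F (flip_point \<omega> x)) t)"
      by (simp only:)
  qed
qed

section \<open>Essential suprema as integrals over levels\<close>

text \<open>An essential bound below 1 forces \<open>P\<close> to fail almost everywhere, and then 0
  is a bound already.\<close>

lemma esssup_of_bool:
  assumes [measurable]: "Measurable.pred M P"
  shows "esssup M (\<lambda>x. of_bool (P x) :: ennreal) = of_bool (\<not> (AE x in M. \<not> P x))"
proof -
  let ?f = "\<lambda>x. of_bool (P x) :: ennreal"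
  have f: "?f \<in> borel_measurable M" by measurable
  show ?thesis
  proof (cases "AE x in M. \<not> P x")
    case True
    then have "esssup M ?f \<le> 0" by (intro esssup_I f) auto
    then show ?thesis using True by simp
  next
    case False
    have "esssup M ?f \<le> 1" by (intro esssup_I f) auto
    moreover have "1 \<le> esssup M ?f"
    proof (rule ccontr)
      assume *: "\<not> 1 \<le> esssup M ?f"
      have "AE x in M. \<not> P x"
        using esssup_AE[of ?f M] by eventually_elim (use * in \<open>auto split: if_splits\<close>)
      then show False using False by contradiction
    qed
    ultimately show ?thesis using False by simp
  qed
qed

lemma emeasure_lborel_atLeast: "emeasure lborel {c :: real..} = \<infinity>"
proof (cases "emeasure lborel {c..}")
  case (real r)
  have "emeasure lborel {c..c + (r + 1)} \<le> emeasure lborel {c..}" by (intro emeasure_mono) auto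
  then show ?thesis using real by (simp add: ennreal_le_iff2)
qed simp

lemma emeasure_lborel_lessThan: "emeasure lborel {..<c :: real} = \<infinity>"
proof (cases "emeasure lborel {..<c}")
  case (real r)
  have "emeasure lborel {c - (r + 1)..<c} \<le> emeasure lborel {..<c}" by (intro emeasure_mono) auto
  then show ?thesis using real by (simp add: ennreal_le_iff2)
qed simp

text \<open>A level \<open>t < c\<close> is decided by comparing \<open>c - t\<close> with the
  essential supremum \<open>?e\<close>: it counts if \<open>c - t\<close> is smaller and does not
  count if it is larger. The counted levels thus form an interval of length \<open>?e\<close> ending
  at \<open>c\<close>, up to one endpoint.\<close>

lemma esssup_decrease_eq_nn_integral:
  fixes g :: "'b \<Rightarrow> real"
  assumes [measurable]: "g \<in> borel_measurable M"
  shows "esssup M (\<lambda>x. ennreal (c - g x)) = (\<integral>\<^sup>+ t. of_bool (t < c \<and> \<not> (AE x in M. t < g x)) \<partial>lborel)"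
    (is "?e = (\<integral>\<^sup>+ t. of_bool (?T t) \<partial>lborel)")
proof -
  have above: "\<not> ?T t" if "?e < ennreal (c - t)" for t
  proof -
    have "AE x in M. t < g x"
      using esssup_AE[of "\<lambda>x. ennreal (c - g x)" M]
    proof eventually_elim
      case (elim x)
      then have "ennreal (c - g x) < ennreal (c - t)" using that by (rule le_less_trans)
      then show ?case by (rule contrapos_pp) (simp add: not_less ennreal_leI)
    qed
    then show ?thesis by simp
  qed
  \<comment> \<open>By contraposition: if \<open>t < g x\<close> almost everywhere, then
    \<open>c - t\<close> is an essential bound.\<close>
  have below: "?T t" if "t < c" "ennreal (c - t) < ?e" for t
  proof -
    have "?e \<le> ennreal (c - t)" if "AE x in M. t < g x"
      using that by (intro esssup_I) (auto intro: ennreal_leI elim!: eventually_mono)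
    then show ?thesis using that by (auto simp: not_le[symmetric])
  qed
  show ?thesis
  proof (cases ?e)
    case top
    \<comment> \<open>With an infinite supremum every level below \<open>c\<close> counts, and the
      half-line has infinite length.\<close>
    then have "(\<integral>\<^sup>+ t. of_bool (?T t) \<partial>lborel) = (\<integral>\<^sup>+ t. indicator {..<c} t \<partial>lborel)"
      using below by (intro nn_integral_cong) (auto simp: indicator_def)
    then show ?thesis using top by (simp add: emeasure_lborel_lessThan)
  next
    case (real r)
    \<comment> \<open>At \<open>t = c - r\<close> neither comparison is strict, so the level is
      undecided; it is a single point and hence negligible.\<close>
    have "AE t in lborel. of_bool (?T t) = (indicator {c - r<..<c} t :: ennreal)"
      using AE_lborel_singleton[of "c - r"]
    proof eventually_elim
      case (elim t)
      show ?case
      proof (cases "t < c")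
        case True
        then show ?thesis
          using elim above[of t] below[of t] real
          by (cases "c - t < r") (auto simp: ennreal_less_iff indicator_def)
      qed auto
    qed
    then have "(\<integral>\<^sup>+ t. of_bool (?T t) \<partial>lborel) = (\<integral>\<^sup>+ t. indicator {c - r<..<c} t \<partial>lborel)"
      by (rule nn_integral_cong_AE)
    then show ?thesis using real by simp
  qed
qed

text \<open>Mirror image of the decreasing case, with levels above \<open>c\<close>. The comparisons
  are non-strict because \<open>F \<omega> \<le> t\<close> is the complement of
  \<open>t < F \<omega>\<close>; the undecided level is now \<open>c + r\<close>.\<close>

lemma esssup_increase_eq_nn_integral:
  fixes g :: "'b \<Rightarrow> real"
  assumes [measurable]: "g \<in> borel_measurable M"
  shows "esssup M (\<lambda>x. ennreal (g x - c)) = (\<integral>\<^sup>+ t. of_bool (c \<le> t \<and> \<not> (AE x in M. g x \<le> t)) \<partial>lborel)"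
    (is "?e = (\<integral>\<^sup>+ t. of_bool (?T t) \<partial>lborel)")
proof -
  have above: "\<not> ?T t" if "?e < ennreal (t - c)" for t
  proof -
    have "AE x in M. g x \<le> t"
      using esssup_AE[of "\<lambda>x. ennreal (g x - c)" M]
    proof eventually_elim
      case (elim x)
      then have "ennreal (g x - c) < ennreal (t - c)" using that by (rule le_less_trans)
      then show ?case by (rule contrapos_pp) (simp add: not_less ennreal_leI)
    qed
    then show ?thesis by simp
  qed
  have below: "?T t" if "c \<le> t" "ennreal (t - c) < ?e" for t
  proof -
    have "?e \<le> ennreal (t - c)" if "AE x in M. g x \<le> t"
      using that by (intro esssup_I) (auto intro: ennreal_leI elim!: eventually_mono)
    then show ?thesis using that by (auto simp: not_le[symmetric])
  qed
  show ?thesis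
  proof (cases ?e)
    case top
    then have "(\<integral>\<^sup>+ t. of_bool (?T t) \<partial>lborel) = (\<integral>\<^sup>+ t. indicator {c..} t \<partial>lborel)"
      using below by (intro nn_integral_cong) (auto simp: indicator_def)
    then show ?thesis using top by (simp add: emeasure_lborel_atLeast)
  next
    case (real r)
    have "AE t in lborel. of_bool (?T t) = (indicator {c..<c + r} t :: ennreal)"
      using AE_lborel_singleton[of "c + r"]
    proof eventually_elim
      case (elim t)
      show ?case
      proof (cases "c \<le> t")
        case True
        then show ?thesis
          using elim above[of t] below[of t] real
          by (cases "t - c < r") (auto simp: ennreal_less_iff indicator_def)
      qed auto
    qed
    then have "(\<integral>\<^sup>+ t. of_bool (?T t) \<partial>lborel) = (\<integral>\<^sup>+ t. indicator {c..<c + r} t \<partial>lborel)"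
      by (rule nn_integral_cong_AE)
    then show ?thesis using real by simp
  qed
qed

section \<open>Norms of the differences of level-set indicators\<close>

lemma Linfty_norm_D_plus: "Linfty_norm M (D_plus F \<omega>) = esssup M (\<lambda>x. ennreal (F \<omega> - F (flip_point \<omega> x)))"
proof -
  have "ennreal \<bar>max 0 y\<bar> = ennreal y" for y :: real by (cases "y \<ge> 0") (auto simp: ennreal_neg)
  then show ?thesis by (simp add: Linfty_norm_def D_plus_def D_eq_flip_point)
qed

lemma Linfty_norm_D_minus: "Linfty_norm M (D_minus F \<omega>) = esssup M (\<lambda>x. ennreal (F (flip_point \<omega> x) - F \<omega>))"
proof -
  have "ennreal \<bar>- min 0 (y - z)\<bar> = ennreal (z - y)" for y z :: real
    by (cases "y \<ge> z") (auto simp: ennreal_neg)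
  then show ?thesis by (simp add: Linfty_norm_def D_minus_def D_eq_flip_point)
qed

context
  fixes M :: "'a::metric_space measure" and F :: "'a measure \<Rightarrow> real" and \<omega> :: "'a measure" and t :: real
  assumes [measurable]: "(\<lambda>x. F (flip_point \<omega> x)) \<in> borel_measurable M"
begin

text \<open>The positive part is 1 exactly where the flip leads from above level \<open>t\<close> to
  at most \<open>t\<close>, and 0 elsewhere; the condition on \<open>F \<omega>\<close> does not
  depend on \<open>x\<close> and leaves the quantifier.\<close>

lemma Linfty_norm_D_plus_indicator:
  "Linfty_norm M (D_plus (indicator {\<omega>. F \<omega> > t}) \<omega>)
    = of_bool (t < F \<omega> \<and> \<not> (AE x in M. t < F (flip_point \<omega> x)))"
proof -
  have "Linfty_norm M (D_plus (indicator {\<omega>. F \<omega> > t}) \<omega>)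
      = esssup M (\<lambda>x. of_bool (t < F \<omega> \<and> \<not> t < F (flip_point \<omega> x)))"
    unfolding Linfty_norm_D_plus by (intro arg_cong[where f="esssup M"]) (auto simp: indicator_def ennreal_neg)
  also have "\<dots> = of_bool (\<not> (AE x in M. \<not> (t < F \<omega> \<and> \<not> t < F (flip_point \<omega> x))))"
    by (rule esssup_of_bool) measurable
  finally show ?thesis by (cases "t < F \<omega>") auto
qed

lemma Linfty_norm_D_minus_indicator:
  "Linfty_norm M (D_minus (indicator {\<omega>. F \<omega> > t}) \<omega>)
    = of_bool (F \<omega> \<le> t \<and> \<not> (AE x in M. F (flip_point \<omega> x) \<le> t))"
proof -
  have "Linfty_norm M (D_minus (indicator {\<omega>. F \<omega> > t}) \<omega>)
      = esssup M (\<lambda>x. of_bool (F \<omega> \<le> t \<and> \<not> F (flip_point \<omega> x) \<le> t))"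
    unfolding Linfty_norm_D_minus by (intro arg_cong[where f="esssup M"]) (auto simp: indicator_def ennreal_neg)
  also have "\<dots> = of_bool (\<not> (AE x in M. \<not> (F \<omega> \<le> t \<and> \<not> F (flip_point \<omega> x) \<le> t)))"
    by (rule esssup_of_bool) measurable
  finally show ?thesis by (cases "F \<omega> \<le> t") auto
qed

text \<open>The sign of the difference is governed by whether \<open>t < F \<omega>\<close>,
  uniformly in \<open>x\<close>. So the absolute difference is one of the two parts for every
  \<open>x\<close>, and the other part has norm 0.\<close>

lemma Linfty_norm_D_indicator:
  "Linfty_norm M (D (indicator {\<omega>. F \<omega> > t}) \<omega>)
    = Linfty_norm M (D_plus (indicator {\<omega>. F \<omega> > t}) \<omega>)
      + Linfty_norm M (D_minus (indicator {\<omega>. F \<omega> > t}) \<omega>)"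
proof (cases "t < F \<omega>")
  case True
  then have "Linfty_norm M (D (indicator {\<omega>. F \<omega> > t}) \<omega>)
      = Linfty_norm M (D_plus (indicator {\<omega>. F \<omega> > t}) \<omega>)"
    unfolding Linfty_norm_D_plus unfolding Linfty_norm_def D_eq_flip_point
    by (intro arg_cong[where f="esssup M"]) (auto simp: indicator_def)
  then show ?thesis using True Linfty_norm_D_minus_indicator by simp
next
  case False
  then have "Linfty_norm M (D (indicator {\<omega>. F \<omega> > t}) \<omega>)
      = Linfty_norm M (D_minus (indicator {\<omega>. F \<omega> > t}) \<omega>)"
    unfolding Linfty_norm_D_minus unfolding Linfty_norm_def D_eq_flip_point
    by (intro arg_cong[where f="esssup M"]) (auto simp: indicator_def)
  then show ?thesis using False Linfty_norm_D_plus_indicator by simp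
qed

end

section \<open>Almost sure finiteness, Tonelli's theorem and the coarea formulas\<close>

text \<open>The Poisson weights of the total mass add up to 1 by the exponential series, so the
  total mass is almost surely a natural number.\<close>

lemma poisson_measure_AE_finite:
  fixes \<sigma> :: "'a::metric_space measure"
  assumes \<sigma>: "finite_measure \<sigma>" and \<pi>: "poisson_measure \<sigma> \<pi>"
  shows "AE \<omega> in \<pi>. emeasure \<omega> UNIV < \<infinity>"
proof -
  interpret prob_space \<pi> using \<pi> by (simp add: poisson_measure_def)
  have sets: "sets \<pi> = sets configuration_space" using \<pi> by (simp add: poisson_measure_def)
  let ?E = "\<lambda>k::nat. {\<omega> \<in> space \<pi>. emeasure \<omega> UNIV = of_nat k}"
  have [measurable]: "(\<lambda>\<omega>. emeasure \<omega> UNIV) \<in> borel_measurable \<pi>"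
    using measurable_emeasure_configuration_space[of UNIV] measurable_cong_sets[OF sets refl] by auto
  have E: "range ?E \<subseteq> events" by auto
  have prob: "prob (?E k) = measure \<sigma> UNIV ^ k / fact k * exp (- measure \<sigma> UNIV)" for k
    using \<pi> by (simp add: poisson_measure_def)
  have "(\<lambda>k. prob (?E k)) sums prob (\<Union>k. ?E k)"
    by (rule finite_measure_UNION[OF E]) (auto simp: disjoint_family_on_def)
  moreover have "(\<lambda>k. prob (?E k)) sums (exp (measure \<sigma> UNIV) * exp (- measure \<sigma> UNIV))"
    unfolding prob using exp_converges[of "measure \<sigma> UNIV"]
    by (intro sums_mult2) (simp add: divide_inverse_commute)
  ultimately have "prob (\<Union>k. ?E k) = 1"
    using sums_unique2 by (fastforce simp: exp_minus)
  then have "AE \<omega> in \<pi>. \<omega> \<in> (\<Union>k. ?E k)"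
    using E by (subst prob_eq_1[symmetric]) auto
  then show ?thesis
    by eventually_elim (auto simp: of_nat_less_top)
qed

text \<open>Tonelli's theorem is applied to the indicator of \<open>A\<close>, which is jointly
  measurable; \<open>f\<close> and \<open>e\<close> need only agree with it and with its level
  integral for almost every \<omega>. The exceptional set in \<open>f\<close> is common to all
  \<open>t\<close>, so \<open>f\<close> can be exchanged for the indicator in either order of
  integration.\<close>

lemma nn_integral_coarea:
  fixes \<pi> :: "'b measure"
  assumes "sigma_finite_measure \<pi>"
    and A: "A \<in> sets (\<pi> \<Otimes>\<^sub>M (borel :: real measure))"
    and f: "AE \<omega> in \<pi>. \<forall>t. f t \<omega> = indicator A (\<omega>, t)"
    and e: "AE \<omega> in \<pi>. e \<omega> = (\<integral>\<^sup>+ t. f t \<omega> \<partial>lborel)"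
  shows "(\<integral>\<^sup>+ \<omega>. e \<omega> \<partial>\<pi>) = (\<integral>\<^sup>+ t. (\<integral>\<^sup>+ \<omega>. f t \<omega> \<partial>\<pi>) \<partial>lborel)"
proof -
  interpret pair_sigma_finite \<pi> "lborel :: real measure"
    using assms(1) by (simp add: pair_sigma_finite_def sigma_finite_lborel)
  have "A \<in> sets (\<pi> \<Otimes>\<^sub>M lborel)"
    using A sets_pair_measure_cong[OF refl sets_lborel, of \<pi>] by simp
  then have ind: "case_prod (\<lambda>\<omega> t. indicator A (\<omega>, t) :: ennreal) \<in> borel_measurable (\<pi> \<Otimes>\<^sub>M lborel)"
    by (simp add: case_prod_beta)
  have "(\<integral>\<^sup>+ \<omega>. e \<omega> \<partial>\<pi>) = (\<integral>\<^sup>+ \<omega>. (\<integral>\<^sup>+ t. indicator A (\<omega>, t) \<partial>lborel) \<partial>\<pi>)"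
  proof (rule nn_integral_cong_AE)
    show "AE \<omega> in \<pi>. e \<omega> = (\<integral>\<^sup>+ t. indicator A (\<omega>, t) \<partial>lborel)"
      using e f by eventually_elim simp
  qed
  also have "\<dots> = (\<integral>\<^sup>+ t. (\<integral>\<^sup>+ \<omega>. indicator A (\<omega>, t) \<partial>\<pi>) \<partial>lborel)"
    by (rule Fubini'[OF ind, symmetric])
  also have "\<dots> = (\<integral>\<^sup>+ t. (\<integral>\<^sup>+ \<omega>. f t \<omega> \<partial>\<pi>) \<partial>lborel)"
  proof (rule nn_integral_cong, rule nn_integral_cong_AE)
    show "AE \<omega> in \<pi>. indicator A (\<omega>, t) = f t \<omega>" for t
      using f by eventually_elim simp
  qed
  finally show ?thesis .
qed

theorem lemma5p1:
  fixes \<sigma> :: "'a::metric_space measure"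
    and \<pi> :: "'a measure measure"
    and F :: "'a measure \<Rightarrow> real"
  assumes "finite_measure \<sigma>"
    and "diffuse_measure \<sigma>"
    and "poisson_measure \<sigma> \<pi>"
    and "F \<in> borel_measurable configuration_space"
  shows
    "(\<integral>\<^sup>+ \<omega>. Linfty_norm (sum_measure \<sigma> \<omega>) (D_plus F \<omega>) \<partial>\<pi>)
       = (\<integral>\<^sup>+ t. (\<integral>\<^sup>+ \<omega>. Linfty_norm (sum_measure \<sigma> \<omega>)
             (D_plus (indicator {\<omega>. F \<omega> > t}) \<omega>) \<partial>\<pi>) \<partial>(lborel :: real measure)) \<and>
     (\<integral>\<^sup>+ \<omega>. Linfty_norm (sum_measure \<sigma> \<omega>) (D_minus F \<omega>) \<partial>\<pi>)
       = (\<integral>\<^sup>+ t. (\<integral>\<^sup>+ \<omega>. Linfty_norm (sum_measure \<sigma> \<omega>)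
             (D_minus (indicator {\<omega>. F \<omega> > t}) \<omega>) \<partial>\<pi>) \<partial>(lborel :: real measure)) \<and>
     (\<integral>\<^sup>+ \<omega>. Linfty_norm (sum_measure \<sigma> \<omega>) (D_plus F \<omega>) \<partial>\<pi>)
       + (\<integral>\<^sup>+ \<omega>. Linfty_norm (sum_measure \<sigma> \<omega>) (D_minus F \<omega>) \<partial>\<pi>)
       = (\<integral>\<^sup>+ t. (\<integral>\<^sup>+ \<omega>. Linfty_norm (sum_measure \<sigma> \<omega>)
             (D (indicator {\<omega>. F \<omega> > t}) \<omega>) \<partial>\<pi>) \<partial>(lborel :: real measure))"
proof -
  interpret prob_space \<pi> using assms(3) by (simp add: poisson_measure_def)
  have sets: "sets \<pi> = sets configuration_space" using assms(3) by (simp add: poisson_measure_def)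
  have space: "space \<pi> = configurations"
    using sets_eq_imp_space_eq[OF sets] by (simp add: space_configuration_space)
  have [measurable]: "F \<in> borel_measurable \<pi>"
    using assms(4) measurable_cong_sets[OF sets refl] by auto
  let ?P = "\<lambda>t \<omega>. Linfty_norm (sum_measure \<sigma> \<omega>) (D_plus (indicator {\<omega>. F \<omega> > t}) \<omega>)"
  let ?N = "\<lambda>t \<omega>. Linfty_norm (sum_measure \<sigma> \<omega>) (D_minus (indicator {\<omega>. F \<omega> > t}) \<omega>)"
  have fin: "AE \<omega> in \<pi>. \<omega> \<in> configurations \<and> emeasure \<omega> UNIV < \<infinity>"
    using poisson_measure_AE_finite[OF assms(1,3)] AE_space by eventually_elim (simp add: space)
  have meas: "(\<lambda>x. F (flip_point \<omega> x)) \<in> borel_measurable (sum_measure \<sigma> \<omega>)"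
    if \<omega>: "\<omega> \<in> configurations \<and> emeasure \<omega> UNIV < \<infinity>" for \<omega>
  proof -
    have "sets (sum_measure \<sigma> \<omega>) = sets borel"
      using assms(2) \<omega> by (simp add: sets_sum_measure sets_configuration diffuse_measure_def)
    from measurable_cong_sets[OF this refl] show ?thesis
      using borel_measurable_flip_point[OF assms(4)] \<omega> by auto
  qed
  obtain A where A: "A \<in> sets (configuration_space \<Otimes>\<^sub>M (borel :: real measure))"
    "\<And>\<omega> t. \<omega> \<in> configurations \<Longrightarrow> emeasure \<omega> UNIV < \<infinity> \<Longrightarrow>
      (\<omega>, t) \<in> A \<longleftrightarrow> (AE x in sum_measure \<sigma> \<omega>. t < F (flip_point \<omega> x))"
    by (rule sets_AE_flip_point[OF assms(1,2,4), of "\<lambda>s t. t < s"]) auto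
  obtain B where B: "B \<in> sets (configuration_space \<Otimes>\<^sub>M (borel :: real measure))"
    "\<And>\<omega> t. \<omega> \<in> configurations \<Longrightarrow> emeasure \<omega> UNIV < \<infinity> \<Longrightarrow>
      (\<omega>, t) \<in> B \<longleftrightarrow> (AE x in sum_measure \<sigma> \<omega>. F (flip_point \<omega> x) \<le> t)"
    by (rule sets_AE_flip_point[OF assms(1,2,4), of "\<lambda>s t. s \<le> t"]) auto
  have [measurable]: "A \<in> sets (\<pi> \<Otimes>\<^sub>M borel)" "B \<in> sets (\<pi> \<Otimes>\<^sub>M borel)"
    using A(1) B(1) sets_pair_measure_cong[OF sets refl] by auto
  \<comment> \<open>\<open>?A\<close> and \<open>?B\<close> collect the pairs
    \<open>(\<omega>, t)\<close> at which the norm of the positive or the negative part of the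
    indicator's difference is 1, for \<omega> of finite mass.\<close>
  let ?A = "{z \<in> space (\<pi> \<Otimes>\<^sub>M borel). snd z < F (fst z)} - A"
  let ?B = "{z \<in> space (\<pi> \<Otimes>\<^sub>M borel). F (fst z) \<le> snd z} - B"
  have AB: "?A \<in> sets (\<pi> \<Otimes>\<^sub>M borel)" "?B \<in> sets (\<pi> \<Otimes>\<^sub>M borel)" by measurable
  have P: "AE \<omega> in \<pi>. \<forall>t. ?P t \<omega> = indicator ?A (\<omega>, t)"
    using fin
  proof eventually_elim
    case (elim \<omega>)
    then show ?case
      unfolding Linfty_norm_D_plus_indicator[OF meas[OF elim]]
      by (auto simp: indicator_def A(2) space_pair_measure space)
  qed
  have N: "AE \<omega> in \<pi>. \<forall>t. ?N t \<omega> = indicator ?B (\<omega>, t)"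
    using fin
  proof eventually_elim
    case (elim \<omega>)
    then show ?case
      unfolding Linfty_norm_D_minus_indicator[OF meas[OF elim]]
      by (auto simp: indicator_def B(2) space_pair_measure space)
  qed
  have 1: "(\<integral>\<^sup>+ \<omega>. Linfty_norm (sum_measure \<sigma> \<omega>) (D_plus F \<omega>) \<partial>\<pi>) = (\<integral>\<^sup>+ t. (\<integral>\<^sup>+ \<omega>. ?P t \<omega> \<partial>\<pi>) \<partial>lborel)"
  proof (rule nn_integral_coarea[OF sigma_finite_measure_axioms AB(1) P])
    show "AE \<omega> in \<pi>. Linfty_norm (sum_measure \<sigma> \<omega>) (D_plus F \<omega>) = (\<integral>\<^sup>+ t. ?P t \<omega> \<partial>lborel)"
      using fin
    proof eventually_elim
      case (elim \<omega>)
      show ?case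
        unfolding Linfty_norm_D_plus_indicator[OF meas[OF elim]] unfolding Linfty_norm_D_plus
        by (rule esssup_decrease_eq_nn_integral[OF meas[OF elim]])
    qed
  qed
  have 2: "(\<integral>\<^sup>+ \<omega>. Linfty_norm (sum_measure \<sigma> \<omega>) (D_minus F \<omega>) \<partial>\<pi>) = (\<integral>\<^sup>+ t. (\<integral>\<^sup>+ \<omega>. ?N t \<omega> \<partial>\<pi>) \<partial>lborel)"
  proof (rule nn_integral_coarea[OF sigma_finite_measure_axioms AB(2) N])
    show "AE \<omega> in \<pi>. Linfty_norm (sum_measure \<sigma> \<omega>) (D_minus F \<omega>) = (\<integral>\<^sup>+ t. ?N t \<omega> \<partial>lborel)"
      using fin
    proof eventually_elim
      case (elim \<omega>)
      show ?case
        unfolding Linfty_norm_D_minus_indicator[OF meas[OF elim]] unfolding Linfty_norm_D_minus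
        by (rule esssup_increase_eq_nn_integral[OF meas[OF elim]])
    qed
  qed
  \<comment> \<open>For the third formula, additivity of \<open>nn_integral\<close> requires
    measurable integrands, so the norms are traded for indicators.\<close>
  have PA: "(\<integral>\<^sup>+ \<omega>. ?P t \<omega> \<partial>\<pi>) = (\<integral>\<^sup>+ \<omega>. indicator ?A (\<omega>, t) \<partial>\<pi>)" for t
  proof (rule nn_integral_cong_AE)
    show "AE \<omega> in \<pi>. ?P t \<omega> = indicator ?A (\<omega>, t)" using P by eventually_elim blast
  qed
  have NB: "(\<integral>\<^sup>+ \<omega>. ?N t \<omega> \<partial>\<pi>) = (\<integral>\<^sup>+ \<omega>. indicator ?B (\<omega>, t) \<partial>\<pi>)" for t
  proof (rule nn_integral_cong_AE)
    show "AE \<omega> in \<pi>. ?N t \<omega> = indicator ?B (\<omega>, t)" using N by eventually_elim blast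
  qed
  have ind: "(\<lambda>\<omega>. indicator C (\<omega>, t) :: ennreal) \<in> borel_measurable \<pi>"
    and int: "(\<lambda>t. \<integral>\<^sup>+ \<omega>. indicator C (\<omega>, t) \<partial>\<pi>) \<in> borel_measurable lborel"
    if [measurable]: "C \<in> sets (\<pi> \<Otimes>\<^sub>M borel)" for C and t :: real
    by measurable
  have "(\<integral>\<^sup>+ t. (\<integral>\<^sup>+ \<omega>. Linfty_norm (sum_measure \<sigma> \<omega>) (D (indicator {\<omega>. F \<omega> > t}) \<omega>) \<partial>\<pi>) \<partial>lborel)
      = (\<integral>\<^sup>+ t. (\<integral>\<^sup>+ \<omega>. indicator ?A (\<omega>, t) + indicator ?B (\<omega>, t) \<partial>\<pi>) \<partial>lborel)"
  proof (rule nn_integral_cong, rule nn_integral_cong_AE)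
    show "AE \<omega> in \<pi>. Linfty_norm (sum_measure \<sigma> \<omega>) (D (indicator {\<omega>. F \<omega> > t}) \<omega>)
        = indicator ?A (\<omega>, t) + indicator ?B (\<omega>, t)" for t
      using fin P N by eventually_elim (simp only: Linfty_norm_D_indicator[OF meas])
  qed
  also have "\<dots> = (\<integral>\<^sup>+ t. (\<integral>\<^sup>+ \<omega>. ?P t \<omega> \<partial>\<pi>) + (\<integral>\<^sup>+ \<omega>. ?N t \<omega> \<partial>\<pi>) \<partial>lborel)"
    unfolding PA NB by (intro nn_integral_cong nn_integral_add ind AB)
  also have "\<dots> = (\<integral>\<^sup>+ t. (\<integral>\<^sup>+ \<omega>. ?P t \<omega> \<partial>\<pi>) \<partial>lborel) + (\<integral>\<^sup>+ t. (\<integral>\<^sup>+ \<omega>. ?N t \<omega> \<partial>\<pi>) \<partial>lborel)"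
    unfolding PA NB by (intro nn_integral_add int AB)
  finally show ?thesis using 1 2 by simp
qed

end
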